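(* Let $f\colon\mathbb{R}^n\to\mathbb{R}$ have a continuous gradient, be pseudoconvex, and have a global minimizer. Let $\{x_k\}_{k\ge 0}$ be a sequence generated by the regularized method (described in the context) with parameters $r\in[3,\infty)$, $\tau\in[0,\infty)$, $\eta>0$, $\sigma_{\max}\in[0,\infty)$ and symmetric matrices $\{Q_k\}$. Suppose that there are a real number $a>2\tau$ and a sequence $\{\psi_k\}\subseteq[0,\infty)$ with $\sum_{k=0}^\infty\psi_k<\infty$ such that, for all $k\ge 0$, $Q_k\succeq aI$ and $Q_{k+1}\preceq(1+\psi_k)Q_k$. Then there exists $x^*\in\mathbb{R}^n$ such that $\lim_{k\to\infty}x_k=x^*$.
   Context: $\|\cdot\|$ is the Euclidean norm. A continuously differentiable $f$ is pseudoconvex if, for all $x,y\in\mathbb{R}^n$, $\nabla f(x)^T(y-x)\ge 0$ implies $f(y)\ge f(x)$. For symmetric matrices, $A\preceq B$ (equivalently $B \succeq A$) means $B-A$ is positive semidefinite. Regularized method. Given $r\in[3,\infty)$, $\tau\in[0,\infty)$, $\eta>0$, $\sigma_{\max}\in[0,\infty)$ and a starting point $x_0\in\mathbb{R}^n$, at each iteration $k=0,1,\ldots$ one takes some $\sigma_k\in[0,\sigma_{\max}]$ and some symmetric matrix $Q_k\in\mathbb{R}^{n\times n}$, defines the model $$m_k(s)=f(x_k)+\nabla f(x_k)^Ts+\tfrac12 s^TQ_ks+\tfrac{\sigma_k}{r}\|s\|^r,$$ takes some $s_k\in\mathbb{R}^n$ with $\|\nabla m_k(s_k)\|\le\tau\|s_k\|\min\{\|s_k\|,1\}$,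 and sets either $x_{k+1}=x_k+s_k$ or $x_{k+1}=x_k$ in such a way that $$x_{k+1}\ne x_k\ \Rightarrow\ f(x_k)-f(x_{k+1})\ge\eta\,(m_k(0)-m_k(s_k))>0.$$ *)

theory Defs
  imports "HOL-Analysis.Analysis"
begin

definition gradient :: "('a::euclidean_space \<Rightarrow> real) \<Rightarrow> 'a \<Rightarrow> 'a" where
  "gradient f x = (THE D. GDERIV f x :> D)"

lemma gradient_eqI:
  fixes f :: "'a::euclidean_space \<Rightarrow> real"
  assumes "GDERIV f x :> D"
  shows "gradient f x = D"
  unfolding gradient_def
proof (rule the_equality)
  show "GDERIV f x :> D" by (fact assms)
next
  fix E assume "GDERIV f x :> E"
  with assms have "(\<lambda>h. h \<bullet> E) = (\<lambda>h. h \<bullet> D)"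
    unfolding gderiv_def by (rule has_derivative_unique[rotated])
  then show "E = D"
    by (metis vector_eq_ldot)
qed

text \<open>By Riesz representation, \<^term>\<open>gradient f x\<close> is meaningful at every point of differentiability.\<close>

lemma gderiv_gradient:
  fixes f :: "'a::euclidean_space \<Rightarrow> real"
  assumes "f differentiable (at x)"
  shows "GDERIV f x :> gradient f x"
proof -
  from assms obtain L where L: "(f has_derivative L) (at x)"
    unfolding differentiable_def by blast
  then have lin: "linear L"
    by (rule has_derivative_linear)
  define D where "D = adjoint L 1"
  have "h \<bullet> D = L h" for h
    using adjoint_works[OF lin, of h 1] by (simp add: D_def)
  then have "L = (\<lambda>h. h \<bullet> D)" by auto
  with L have "GDERIV f x :> D"
    by (simp add: gderiv_def)
  then show ?thesis
    using gradient_eqI by metis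
qed

definition continuously_differentiable :: "('a::euclidean_space \<Rightarrow> real) \<Rightarrow> bool" where
  "continuously_differentiable f \<longleftrightarrow>
     (\<forall>x. f differentiable (at x)) \<and> continuous_on UNIV (gradient f)"

text \<open>Only meant for functions that are \<^const>\<open>continuously_differentiable\<close>.\<close>

definition pseudoconvex :: "('a::euclidean_space \<Rightarrow> real) \<Rightarrow> bool" where
  "pseudoconvex f \<longleftrightarrow> (\<forall>x y. gradient f x \<bullet> (y - x) \<ge> 0 \<longrightarrow> f y \<ge> f x)"

definition symmetric_matrix :: "real ^ 'n ^ 'n \<Rightarrow> bool" where
  "symmetric_matrix A \<longleftrightarrow> transpose A = A"

definition positive_semidefinite :: "real ^ 'n ^ 'n \<Rightarrow> bool" where
  "positive_semidefinite A \<longleftrightarrow> symmetric_matrix A \<and> (\<forall>v. v \<bullet> (A *v v) \<ge> 0)"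

definition loewner_le :: "real ^ 'n ^ 'n \<Rightarrow> real ^ 'n ^ 'n \<Rightarrow> bool"
    (infix \<open>\<preceq>\<close> 50) where
  "A \<preceq> B \<longleftrightarrow> positive_semidefinite (B - A)"

definition model ::
    "(real ^ 'n \<Rightarrow> real) \<Rightarrow> real \<Rightarrow> real ^ 'n \<Rightarrow> real ^ 'n ^ 'n \<Rightarrow> real \<Rightarrow> real ^ 'n \<Rightarrow> real" where
  "model f r x Q \<sigma> s =
     f x + gradient f x \<bullet> s + (1/2) * (s \<bullet> (Q *v s)) + (\<sigma> / r) * norm s powr r"

text \<open>
  The sequences \<open>x\<close>, \<open>\<sigma>\<close> and \<open>s\<close> form a run of the regularized method with
  matrices \<open>Q\<close>. The case of a null step is not restricted further: a step may be
  rejected even if it achieves sufficient decrease.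
\<close>

definition regularized_method ::
    "(real ^ 'n \<Rightarrow> real) \<Rightarrow> real \<Rightarrow> real \<Rightarrow> real \<Rightarrow> real \<Rightarrow>
     (nat \<Rightarrow> real ^ 'n ^ 'n) \<Rightarrow> (nat \<Rightarrow> real) \<Rightarrow> (nat \<Rightarrow> real ^ 'n) \<Rightarrow> (nat \<Rightarrow> real ^ 'n) \<Rightarrow> bool" where
  "regularized_method f r \<tau> \<eta> \<sigma>max Q \<sigma> s x \<longleftrightarrow>
     (\<forall>k. let m = model f r (x k) (Q k) (\<sigma> k) in
        0 \<le> \<sigma> k \<and> \<sigma> k \<le> \<sigma>max \<and>
        symmetric_matrix (Q k) \<and>
        norm (gradient m (s k)) \<le> \<tau> * norm (s k) * min (norm (s k)) 1 \<and>
        (x (Suc k) = x k + s k \<or> x (Suc k) = x k) \<and>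
        (x (Suc k) \<noteq> x k \<longrightarrow>
           f (x k) - f (x (Suc k)) \<ge> \<eta> * (m 0 - m (s k)) \<and>
           \<eta> * (m 0 - m (s k)) > 0))"

end

(* Decreasing the model forces the squared step lengths to be dominated by the decrements of f, so
   they are summable. For any y with f y <= f (x k) for all k, pseudoconvexity gives
   gradient f (x k) . (y - x k) < 0 at successful steps; expanding the squared distance to y in the
   norm of Q k and eliminating Q k s k by means of the gradient of the model shows that these
   distances are quasi-Fejer monotone with summable errors, hence convergent. The sublevel
   condition holds for a minimizer, which makes x bounded, and then for any cluster point l of x;
   along a subsequence the distance to l tends to 0, so it tends to 0 along the whole sequence. *)
theory Submission
  imports Defs
begin

section \<open>Gradient of the model\<close>

lemma symmetric_matrix_inner:
  assumes "symmetric_matrix A"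
  shows "u \<bullet> (A *v v) = v \<bullet> (A *v u)"
  using assms by (metis symmetric_matrix_def dot_lmul_matrix inner_commute transpose_matrix_vector)

lemma GDERIV_quadratic_form:
  fixes A :: "real ^ 'n ^ 'n"
  assumes "symmetric_matrix A"
  shows "GDERIV (\<lambda>s. s \<bullet> (A *v s)) s :> 2 *\<^sub>R (A *v s)"
proof -
  have "((*v) A has_derivative (*v) A) (at s)"
    by (simp add: bounded_linear_imp_has_derivative)
  from has_derivative_inner[OF has_derivative_ident this]
  show ?thesis unfolding gderiv_def by (simp add: symmetric_matrix_inner[OF assms, of _ s])
qed

text \<open>Chain rule through the norm, hence \<open>s \<noteq> 0\<close>; one factor of the norm
  cancels the denominator of \<open>sgn s\<close>, which lowers the exponent to
  \<open>r - 2\<close>.\<close>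

lemma GDERIV_norm_powr:
  fixes s :: "'a::real_inner"
  assumes "s \<noteq> 0"
  shows "GDERIV (\<lambda>s. norm s powr r) s :> (r * norm s powr (r - 2)) *\<^sub>R s"
proof -
  have "DERIV (\<lambda>t. t powr r) (norm s) :> r * norm s powr (r - 1)"
    using assms by (intro has_real_derivative_powr) simp
  from GDERIV_DERIV_compose[OF GDERIV_norm[OF assms] this]
  have "GDERIV (\<lambda>s. norm s powr r) s :> (r * norm s powr (r - 1)) *\<^sub>R sgn s" .
  moreover have "norm s powr (r - 1) = norm s powr (r - 2) * norm s"
    using assms powr_mult_base[of "norm s" "r-2"] by (simp add: mult.commute)
  ultimately show ?thesis using assms by (simp add: sgn_div_norm mult.assoc)
qed

text \<open>Read as an equation for \<open>A *v s\<close>, this is what later trades the matrix term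
  for the gradient of \<open>f\<close> and the small residual of the model.\<close>

lemma gradient_model:
  assumes "symmetric_matrix A" "s \<noteq> 0" "r \<noteq> 0"
  shows "gradient (model f r x A \<sigma>) s
    = gradient f x + A *v s + (\<sigma> * norm s powr (r - 2)) *\<^sub>R s"
proof (rule gradient_eqI)
  have "GDERIV (\<lambda>s. gradient f x \<bullet> s) s :> gradient f x"
    unfolding gderiv_def
    by (auto intro!: derivative_eq_intros simp: inner_commute)
  from GDERIV_add[OF GDERIV_add[OF GDERIV_add[OF GDERIV_const[of "f x"] this]
      GDERIV_mult[OF GDERIV_const[of "1/2"] GDERIV_quadratic_form[OF assms(1)]]]
      GDERIV_mult[OF GDERIV_const[of "\<sigma>/r"] GDERIV_norm_powr[OF assms(2), of r]]]
  show "GDERIV (model f r x A \<sigma>) s :>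
     gradient f x + A *v s + (\<sigma> * norm s powr (r - 2)) *\<^sub>R s"
    using assms(3) by (simp add: model_def[abs_def])
qed

section \<open>Sequences that decrease up to summable errors\<close>

lemma decseq_bdd_below_convergent:
  fixes F :: "nat \<Rightarrow> real"
  assumes "decseq F" "\<And>k. c \<le> F k"
  shows "convergent F"
  using decseq_convergent[of F c] assms by (metis convergentI)

text \<open>Apply \<open>1 + t \<le> exp t\<close> to each factor and bound the partial sum in the
  exponent by the full sum.\<close>

lemma prod_one_plus_bounded:
  fixes p :: "nat \<Rightarrow> real"
  assumes "\<And>k. p k \<ge> 0" "summable p"
  shows "(\<Prod>i<k. 1 + p i) \<le> exp (suminf p)"
proof -
  have "(\<Prod>i<k. 1 + p i) \<le> (\<Prod>i<k. exp (p i))"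
    using assms(1) by (intro prod_mono) (simp add: add_nonneg_nonneg)
  also have "\<dots> = exp (\<Sum>i<k. p i)" by (simp add: exp_sum)
  also have "\<dots> \<le> exp (suminf p)"
    using assms by (simp add: sum_le_suminf)
  finally show ?thesis .
qed

text \<open>Dividing by the partial products of \<open>1 + p\<close> and subtracting the partial sums of
  \<open>q\<close> turns \<open>d\<close> into a decreasing sequence.\<close>

lemma quasi_Fejer_convergent:
  fixes d p q :: "nat \<Rightarrow> real"
  assumes d: "\<And>k. d k \<ge> 0" and p: "\<And>k. p k \<ge> 0" "summable p"
    and q: "\<And>k. q k \<ge> 0" "summable q"
    and step: "\<And>k. d (Suc k) \<le> (1 + p k) * d k + q k"
  shows "convergent d"
proof -
  define P where "P k = (\<Prod>i<k. 1 + p i)" for k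
  define E where "E k = d k / P k - (\<Sum>i<k. q i)" for k
  have P1: "P k \<ge> 1" for k
    unfolding P_def using p(1) by (intro prod_ge_1) simp
  have PSuc: "P (Suc k) = P k * (1 + p k)" for k by (simp add: P_def)
  have "P k \<le> P (Suc k)" for k
    unfolding PSuc using P1[of k] p(1)[of k] by (simp add: mult_le_cancel_left1)
  then have "incseq P" by (rule incseq_SucI)
  then have convP: "convergent P"
    using prod_one_plus_bounded[OF p] unfolding P_def[symmetric]
    by (metis incseq_convergent convergentI)
  have "E (Suc k) \<le> E k" for k
  proof -
    have pos: "P (Suc k) > 0" "P k > 0" "1 + p k > 0"
      using P1[of k] P1[of "Suc k"] p(1)[of k] by linarith+
    have "d (Suc k) / P (Suc k) \<le> ((1 + p k) * d k + q k) / P (Suc k)"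
      using step pos by (simp add: divide_right_mono)
    also have "\<dots> = d k / P k + q k / P (Suc k)"
      using pos by (simp add: add_divide_distrib PSuc)
    also have "q k / P (Suc k) \<le> q k"
      using q(1)[of k] P1[of "Suc k"] pos by (simp add: divide_le_eq mult_le_cancel_left1)
    finally show ?thesis by (simp add: E_def)
  qed
  then have dec: "decseq E" by (rule decseq_SucI)
  have bd: "- suminf q \<le> E k" for k
  proof -
    have "(\<Sum>i<k. q i) \<le> suminf q" using q by (simp add: sum_le_suminf)
    moreover have "d k / P k \<ge> 0" using d[of k] P1[of k] by simp
    ultimately show ?thesis unfolding E_def by linarith
  qed
  \<comment> \<open>\<open>d\<close> is recovered from \<open>E\<close> by adding the partial sums
    back and multiplying by \<open>P\<close>, both of which converge.\<close>
  have "convergent E"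
    using dec bd by (rule decseq_bdd_below_convergent)
  moreover have "convergent (\<lambda>k. \<Sum>i<k. q i)"
    using q(2) by (simp add: summable_iff_convergent)
  ultimately have "convergent (\<lambda>k. (E k + (\<Sum>i<k. q i)) * P k)"
    using convP by (intro convergent_mult convergent_add)
  moreover have "(E k + (\<Sum>i<k. q i)) * P k = d k" for k
    using P1[of k] by (simp add: E_def)
  ultimately show ?thesis by simp
qed

section \<open>Loewner bounds and estimates for a single step\<close>

lemma loewner_le_quadratic_form:
  "A \<preceq> B \<Longrightarrow> v \<bullet> (A *v v) \<le> v \<bullet> (B *v v)"
  by (simp add: loewner_le_def positive_semidefinite_def matrix_vector_mult_diff_rdistrib
      inner_diff_right)

lemma scaled_identity_loewner_le:
  assumes "a *\<^sub>R mat 1 \<preceq> A"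
  shows "a * (norm v)\<^sup>2 \<le> v \<bullet> (A *v v)"
  using loewner_le_quadratic_form[OF assms, of v]
  by (simp add: scaleR_matrix_vector_assoc[symmetric] dot_square_norm)

lemma summable_decrements:
  fixes F :: "nat \<Rightarrow> real"
  assumes "decseq F" "\<And>k. c \<le> F k"
  shows "summable (\<lambda>k. F k - F (Suc k))"
  using decseq_bdd_below_convergent[OF assms] telescope_summable'
  by (metis convergent_LIMSEQ_iff)

text \<open>Pairing the residual \<open>e\<close> with \<open>s\<close> eliminates
  \<open>gradient f x \<bullet> s\<close> from \<open>\<delta>\<close> and leaves half the quadratic
  form, minus \<open>e \<bullet> s\<close>, plus a nonnegative regularization term. The first bound
  makes squared step lengths summable, the second does the same for the quadratic forms of the
  steps.\<close>

lemma model_decrease_bounds: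
  fixes A :: "real ^ 'n ^ 'n" and s :: "real ^ 'n"
  assumes A: "symmetric_matrix A" "a *\<^sub>R mat 1 \<preceq> A"
    and par: "r \<ge> 3" "a > 2 * \<tau>" "\<tau> \<ge> 0" "\<sigma> \<ge> 0"
    and s: "s \<noteq> 0" "norm (gradient (model f r x A \<sigma>) s) \<le> \<tau> * norm s * min (norm s) 1"
  defines "\<delta> \<equiv> model f r x A \<sigma> 0 - model f r x A \<sigma> s"
  shows "(a / 2 - \<tau>) * (norm s)\<^sup>2 \<le> \<delta>" and "s \<bullet> (A *v s) \<le> 2 * a / (a - 2 * \<tau>) * \<delta>"
proof -
  define e where "e = gradient (model f r x A \<sigma>) s"
  have e_eq: "e = gradient f x + A *v s + (\<sigma> * norm s powr (r - 2)) *\<^sub>R s"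
    unfolding e_def using A s par by (intro gradient_model) auto
  have "norm s powr (r-2) * (norm s)\<^sup>2 = norm s powr r"
    using s(1) by (simp add: powr_diff flip: powr_numeral)
  then have es: "e \<bullet> s = gradient f x \<bullet> s + s \<bullet> (A *v s) + \<sigma> * norm s powr r"
    unfolding e_eq by (simp add: inner_add_left inner_add_right inner_commute[of _ s] dot_square_norm mult.assoc)
  \<comment> \<open>Only the bound 1 on the minimum is used here; the bound \<open>norm s\<close>
    serves in the distance estimate.\<close>
  have "norm e \<le> \<tau> * norm s"
    using s(2) par mult_left_mono[of "min (norm s) 1" 1 "\<tau> * norm s"] unfolding e_def by simp
  then have "norm e * norm s \<le> \<tau> * norm s * norm s"
    by (simp add: mult_right_mono)
  then have es2: "e \<bullet> s \<le> \<tau> * (norm s)\<^sup>2"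
    using norm_cauchy_schwarz[of e s] by (simp add: power2_eq_square mult.assoc)
  have "\<sigma> / r * norm s powr r \<le> \<sigma> * norm s powr r"
    using par by (intro mult_right_mono) (auto simp: divide_le_eq mult_le_cancel_left1)
  then have d: "\<delta> \<ge> s \<bullet> (A *v s) / 2 - \<tau> * (norm s)\<^sup>2"
    using es es2 unfolding \<delta>_def model_def by simp
  have lower: "a * (norm s)\<^sup>2 \<le> s \<bullet> (A *v s)"
    using A(2) by (rule scaled_identity_loewner_le)
  then show "(a / 2 - \<tau>) * (norm s)\<^sup>2 \<le> \<delta>"
    using d by (simp add: algebra_simps)
  \<comment> \<open>Since \<open>(norm s)\<^sup>2\<close> is at most the quadratic form divided by
    \<open>a\<close>, the loss from the residual absorbs only the fraction
    \<open>2 * \<tau> / a < 1\<close> of half the form.\<close>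
  have "(a - 2 * \<tau>) * (s \<bullet> (A *v s)) \<le> 2 * a * \<delta>"
  proof -
    have "(a - 2*\<tau>) * (s \<bullet> (A *v s)) \<le> a * (s \<bullet> (A *v s)) - 2 * \<tau> * (a * (norm s)\<^sup>2)"
      using lower par mult_left_mono[OF lower, of "2*\<tau>"] by (simp add: algebra_simps)
    also have "\<dots> = 2 * a * (s \<bullet> (A *v s) / 2 - \<tau> * (norm s)\<^sup>2)" by (simp add: algebra_simps)
    also have "\<dots> \<le> 2 * a * \<delta>" using d par by (intro mult_left_mono) auto
    finally show ?thesis .
  qed
  then show "s \<bullet> (A *v s) \<le> 2 * a / (a - 2 * \<tau>) * \<delta>"
    using par by (simp add: field_simps)
qed

text \<open>Here \<open>v\<close> stands for the current point minus a reference point. In the cross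
  term, \<open>A *v s\<close> is replaced by \<open>e - gradient f x - c *\<^sub>R s\<close>: the
  gradient part has a favorable sign by the assumption on \<open>v\<close>, and the other two are of
  order \<open>norm v * (norm s)\<^sup>2\<close>.\<close>

lemma step_distance:
  fixes A :: "real ^ 'n ^ 'n" and s v :: "real ^ 'n"
  assumes A: "symmetric_matrix A" "a *\<^sub>R mat 1 \<preceq> A" "a > 0"
    and par: "r \<ge> 3" "\<tau> \<ge> 0" "0 \<le> \<sigma>" "\<sigma> \<le> \<sigma>max"
    and s: "s \<noteq> 0" "norm s \<le> M"
      "norm (gradient (model f r x A \<sigma>) s) \<le> \<tau> * norm s * min (norm s) 1"
    and v: "0 \<le> v \<bullet> gradient f x"
  defines "K \<equiv> \<tau> + \<sigma>max * M powr (r - 3)"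
  shows "(v + s) \<bullet> (A *v (v + s))
    \<le> (1 + K / a * (norm s)\<^sup>2) * (v \<bullet> (A *v v)) + (K * (norm s)\<^sup>2 + s \<bullet> (A *v s))"
proof -
  define e where "e = gradient (model f r x A \<sigma>) s"
  define c where "c = \<sigma> * norm s powr (r - 2)"
  have e_eq: "e = gradient f x + A *v s + c *\<^sub>R s"
    unfolding e_def c_def using A s par by (intro gradient_model) auto
  have expand: "(v + s) \<bullet> (A *v (v + s)) = v \<bullet> (A *v v) + 2 * (v \<bullet> (A *v s)) + s \<bullet> (A *v s)"
    using symmetric_matrix_inner[OF A(1), of s v]
    by (simp add: matrix_vector_right_distrib inner_add_left inner_add_right)
  have "A *v s = e - gradient f x - c *\<^sub>R s" unfolding e_eq by simp
  then have "v \<bullet> (A *v s) = v \<bullet> e - v \<bullet> gradient f x - c * (v \<bullet> s)"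
    by (simp add: inner_diff_right)
  also have "\<dots> \<le> norm v * norm e + c * (norm v * norm s)"
  proof -
    have "c * (- (v \<bullet> s)) \<le> c * (norm v * norm s)"
      using par Cauchy_Schwarz_ineq2[of v s] by (intro mult_left_mono) (auto simp: c_def)
    then show ?thesis using v norm_cauchy_schwarz[of v e] by simp
  qed
  also have "\<dots> \<le> norm v * (K * (norm s)\<^sup>2)"
  proof -
    have e: "norm e \<le> \<tau> * (norm s)\<^sup>2"
      using s(3) par mult_left_mono[of "min (norm s) 1" "norm s" "\<tau> * norm s"]
      unfolding e_def by (simp add: power2_eq_square mult.assoc)
    \<comment> \<open>Two powers of \<open>norm s\<close> are split off; \<open>r \<ge> 3\<close>
      keeps the remaining exponent nonnegative, so that \<open>norm s \<le> M\<close> bounds the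
      rest.\<close>
    have "norm s powr (r - 2) = norm s powr (r - 3) * norm s"
      using s(1) powr_mult_base[of "norm s" "r-3"] by (simp add: mult.commute)
    then have "c * norm s = \<sigma> * norm s powr (r - 3) * (norm s)\<^sup>2"
      by (simp add: c_def power2_eq_square)
    also have "\<dots> \<le> \<sigma>max * M powr (r - 3) * (norm s)\<^sup>2"
      using par s by (intro mult_right_mono mult_mono powr_mono2) auto
    finally have "norm e + c * norm s \<le> K * (norm s)\<^sup>2"
      using e by (simp add: K_def algebra_simps)
    from mult_left_mono[OF this, of "norm v"] show ?thesis by (simp add: algebra_simps)
  qed
  finally have cross: "2 * (v \<bullet> (A *v s)) \<le> (K * (norm s)\<^sup>2) * (2 * norm v)"
    by (simp add: algebra_simps)
  have K0: "K * (norm s)\<^sup>2 \<ge> 0" using par by (simp add: K_def)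
  \<comment> \<open>The term linear in \<open>norm v\<close> is split into a constant, which goes
    into the additive error, and a square, which the quadratic form of \<open>A\<close> absorbs into
    the factor.\<close>
  have "2 * norm v \<le> 1 + (norm v)\<^sup>2"
    using sum_squares_bound[of 1 "norm v"] by simp
  also have "\<dots> \<le> 1 + v \<bullet> (A *v v) / a"
    using scaled_identity_loewner_le[OF A(2), of v] A(3) by (simp add: field_simps)
  finally have "2 * norm v \<le> 1 + v \<bullet> (A *v v) / a" .
  from mult_left_mono[OF this K0] cross show ?thesis
    unfolding expand by (simp add: algebra_simps)
qed


theorem theorem2:
  fixes f :: "real ^ 'n \<Rightarrow> real"
    and r \<tau> \<eta> \<sigma>max a :: real
    and Q :: "nat \<Rightarrow> real ^ 'n ^ 'n"
    and \<sigma> \<psi> :: "nat \<Rightarrow> real"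
    and s x :: "nat \<Rightarrow> real ^ 'n"
  assumes "continuously_differentiable f"
    and "pseudoconvex f"
    and "\<exists>z. \<forall>y. f z \<le> f y"
    and "r \<ge> 3" and "\<tau> \<ge> 0" and "\<eta> > 0" and "\<sigma>max \<ge> 0"
    and "regularized_method f r \<tau> \<eta> \<sigma>max Q \<sigma> s x"
    and "a > 2 * \<tau>"
    and "\<And>k. \<psi> k \<ge> 0" and "summable \<psi>"
    and "\<And>k. a *\<^sub>R mat 1 \<preceq> Q k"
    and "\<And>k. Q (Suc k) \<preceq> (1 + \<psi> k) *\<^sub>R Q k"
  shows "\<exists>xstar. x \<longlonglongrightarrow> xstar"
proof -
  note par = assms(4-7) assms(9)
  have a: "a > 0" using par by linarith
  obtain z where z: "\<And>y. f z \<le> f y" using assms(3) by blast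
  define m where "m k = model f r (x k) (Q k) (\<sigma> k)" for k
  have sig: "0 \<le> \<sigma> k" "\<sigma> k \<le> \<sigma>max" and sym: "symmetric_matrix (Q k)"
    and inexact: "norm (gradient (m k) (s k)) \<le> \<tau> * norm (s k) * min (norm (s k)) 1"
    and alternative: "x (Suc k) = x k + s k \<or> x (Suc k) = x k"
    and decrease: "x (Suc k) \<noteq> x k \<Longrightarrow>
      f (x k) - f (x (Suc k)) \<ge> \<eta> * (m k 0 - m k (s k)) \<and> \<eta> * (m k 0 - m k (s k)) > 0" for k
    using assms(8) unfolding regularized_method_def m_def Let_def by blast+
  \<comment> \<open>All later errors are multiples of \<open>w\<close> or \<open>\<psi>\<close>,
    both summable.\<close>
  define w where "w k = f (x k) - f (x (Suc k))" for k
  have w0: "w k \<ge> 0" for k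
    using decrease[of k] unfolding w_def by (cases "x (Suc k) = x k") auto
  then have decf: "decseq (\<lambda>k. f (x k))"
    by (intro decseq_SucI) (simp add: w_def)
  have sumw: "summable w"
    unfolding w_def using decf z by (rule summable_decrements)
  \<comment> \<open>Chosen to invert
    \<open>\<eta> * (a / 2 - \<tau>) * (norm (s k))\<^sup>2 \<le> w k\<close>; also
    \<open>a * L * \<eta>\<close> is the constant \<open>2 * a / (a - 2 * \<tau>)\<close> of the
    second model bound.\<close>
  define L where "L = 1 / (\<eta> * (a / 2 - \<tau>))"
  have L0: "L > 0" using par by (simp add: L_def)
  have pos: "\<eta> * (a / 2 - \<tau>) > 0" using par by simp
  have step_bounds: "(norm (s k))\<^sup>2 \<le> L * w k" "s k \<bullet> (Q k *v s k) \<le> a * L * w k" "s k \<noteq> 0"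
    if "x (Suc k) \<noteq> x k" for k
  proof -
    show s0: "s k \<noteq> 0" using alternative[of k] that by auto
    note b = model_decrease_bounds[OF sym assms(12) par(1,5,2) sig(1) s0 inexact[unfolded m_def],
        folded m_def]
    have d: "\<eta> * (m k 0 - m k (s k)) \<le> w k" using decrease[OF that] by (simp add: w_def)
    have "(\<eta> * (a / 2 - \<tau>)) * (norm (s k))\<^sup>2 \<le> \<eta> * (m k 0 - m k (s k))"
      using mult_left_mono[OF b(1), of \<eta>] par by (simp add: mult.assoc)
    with d have "(\<eta> * (a / 2 - \<tau>)) * (norm (s k))\<^sup>2 \<le> w k" by linarith
    then show "(norm (s k))\<^sup>2 \<le> L * w k"
      using pos unfolding L_def by (simp add: pos_le_divide_eq mult.commute)
    have "2 * a / (a - 2 * \<tau>) * (m k 0 - m k (s k)) = a * L * (\<eta> * (m k 0 - m k (s k)))"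
      using par by (simp add: L_def field_simps)
    also have "\<dots> \<le> a * L * w k" using d a L0 by (intro mult_left_mono) auto
    finally show "s k \<bullet> (Q k *v s k) \<le> a * L * w k" using b(2) by linarith
  qed
  \<comment> \<open>A single decrement of \<open>f\<close> cannot exceed the total available
    decrease \<open>f (x 0) - f z\<close>.\<close>
  define M where "M = sqrt (L * (f (x 0) - f z))"
  have sM: "norm (s k) \<le> M" if "x (Suc k) \<noteq> x k" for k
  proof -
    have "f (x k) \<le> f (x 0)" using decseqD[OF decf, of 0 k] by simp
    then have "L * w k \<le> L * (f (x 0) - f z)"
      using L0 z[of "x (Suc k)"] by (intro mult_left_mono) (auto simp: w_def)
    with step_bounds(1)[OF that] show ?thesis unfolding M_def by (intro real_le_rsqrt) linarith
  qed
  define K where "K = \<tau> + \<sigma>max * M powr (r - 3)"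
  have K0: "K \<ge> 0" using par by (simp add: K_def)
  \<comment> \<open>A uniform bound on \<open>1 + \<psi> k\<close>, so that the product of
    \<open>1 + \<psi> k\<close> and \<open>1 + u\<close> is at most
    \<open>1 + \<psi> k + B * u\<close>, which has the form \<open>1 + p k\<close>.\<close>
  define B where "B = 1 + suminf \<psi>"
  have psiB: "1 + \<psi> k \<le> B" for k
    using sum_le_suminf[OF assms(11), of "{k}"] assms(10) by (simp add: B_def)
  define p where "p k = \<psi> k + B * (K / a * (L * w k))" for k
  define q where "q k = B * (K * (L * w k) + a * L * w k)" for k
  define D where "D y k = (x k - y) \<bullet> (Q k *v (x k - y))" for y k
  have B0: "B \<ge> 0" using psiB[of 0] assms(10)[of 0] by linarith
  have p0: "p k \<ge> 0" and q0: "q k \<ge> 0" for k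
    using assms(10) B0 K0 a L0 w0 by (auto simp: p_def q_def)
  have sump: "summable p" and sumq: "summable q"
    unfolding p_def q_def using sumw assms(11)
    by (auto intro!: summable_add summable_mult)
  have lower: "a * (norm v)\<^sup>2 \<le> v \<bullet> (Q k *v v)" for v k
    using assms(12) by (rule scaled_identity_loewner_le)
  have nonneg: "v \<bullet> (Q k *v v) \<ge> 0" for v k
    using order_trans[OF _ lower[of v k]] a by simp
  have upper: "v \<bullet> (Q (Suc k) *v v) \<le> (1 + \<psi> k) * (v \<bullet> (Q k *v v))" for v k
    using loewner_le_quadratic_form[OF assms(13), of v k]
    by (simp add: scaleR_matrix_vector_assoc[symmetric])
  have fejer: "D y (Suc k) \<le> (1 + p k) * D y k + q k" if y: "\<And>k. f y \<le> f (x k)" for y k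
  proof -
    \<comment> \<open>The point moves first while the matrix stays \<open>Q k\<close>; the passage
      to \<open>Q (Suc k)\<close> costs the factor \<open>1 + \<psi> k\<close> afterwards.\<close>
    have inner: "(x (Suc k) - y) \<bullet> (Q k *v (x (Suc k) - y))
      \<le> (1 + K / a * (L * w k)) * D y k + (K * (L * w k) + a * L * w k)"
    proof (cases "x (Suc k) = x k")
      case True
      have "D y k \<le> (1 + K / a * (L * w k)) * D y k"
        using K0 a L0 w0[of k] nonneg[of "x k - y" k] by (simp add: D_def mult_le_cancel_right1)
      moreover have "K * (L * w k) + a * L * w k \<ge> 0" using K0 a L0 w0[of k] by simp
      ultimately show ?thesis using True by (simp add: D_def)
    next
      case False
      then have xs: "x (Suc k) - y = (x k - y) + s k" using alternative[of k] by auto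
      \<comment> \<open>Strict decrease turns \<open>f y \<le> f (x (Suc k))\<close> into
        \<open>f y < f (x k)\<close>, as the contrapositive of pseudoconvexity requires.\<close>
      have "w k > 0" using decrease[OF False] by (simp add: w_def)
      then have "f y < f (x k)" using y[of "Suc k"] by (simp add: w_def)
      then have "\<not> gradient f (x k) \<bullet> (y - x k) \<ge> 0"
        using assms(2) unfolding pseudoconvex_def by (metis not_le)
      then have g: "0 \<le> (x k - y) \<bullet> gradient f (x k)"
        by (simp add: inner_diff_right inner_diff_left inner_commute)
      from step_distance[OF sym assms(12) a par(1,2) sig step_bounds(3)[OF False] sM[OF False]
          inexact[unfolded m_def] g, folded K_def]
      have "(x (Suc k) - y) \<bullet> (Q k *v (x (Suc k) - y))
        \<le> (1 + K / a * (norm (s k))\<^sup>2) * D y k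
          + (K * (norm (s k))\<^sup>2 + s k \<bullet> (Q k *v s k))"
        unfolding xs D_def .
      also have "\<dots> \<le> (1 + K / a * (L * w k)) * D y k + (K * (L * w k) + a * L * w k)"
        using step_bounds[OF False] K0 a nonneg[of "x k - y" k]
        by (intro add_mono mult_right_mono mult_left_mono) (auto simp: D_def)
      finally show ?thesis .
    qed
    let ?u = "K / a * (L * w k)" and ?v = "K * (L * w k) + a * L * w k"
    have u0: "?u \<ge> 0" "?v \<ge> 0" using K0 a L0 w0[of k] by auto
    have D0: "D y k \<ge> 0" by (simp add: D_def nonneg)
    have "D y (Suc k) \<le> (1 + \<psi> k) * ((1 + ?u) * D y k + ?v)"
      using upper[of "x (Suc k) - y" k] mult_left_mono[OF inner, of "1 + \<psi> k"] assms(10)[of k]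
      unfolding D_def by linarith
    also have "\<dots> = (1 + \<psi> k + (1 + \<psi> k) * ?u) * D y k + (1 + \<psi> k) * ?v"
      by (simp only: algebra_simps)
    also have "\<dots> \<le> (1 + \<psi> k + B * ?u) * D y k + B * ?v"
      using psiB[of k] u0 D0 by (intro add_mono mult_right_mono) auto
    finally show ?thesis by (simp add: p_def q_def add.assoc)
  qed
  have conv: "convergent (D y)" if "\<And>k. f y \<le> f (x k)" for y
    using p0 sump q0 sumq fejer[OF that] nonneg
    by (intro quasi_Fejer_convergent[of "D y" p q]) (auto simp: D_def)
  have "bounded (range x)"
  proof -
    have "Bseq (D z)" using conv[OF z] by (rule convergent_imp_Bseq)
    then obtain R where R: "\<And>k. norm (D z k) \<le> R" unfolding Bseq_def by blast
    have "norm (x k - z) \<le> sqrt (R / a)" for k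
    proof -
      have "a * (norm (x k - z))\<^sup>2 \<le> R"
        using lower[of "x k - z" k] R[of k] unfolding D_def by (simp add: abs_le_iff)
      then show ?thesis using a by (intro real_le_rsqrt) (simp add: field_simps)
    qed
    then have "range x \<subseteq> cball z (sqrt (R / a))"
      by (auto simp: dist_norm norm_minus_commute)
    then show ?thesis by (rule bounded_subset[OF bounded_cball])
  qed
  then obtain l h where h: "strict_mono h" and lim: "(x \<circ> h) \<longlonglongrightarrow> l"
    using bounded_imp_convergent_subsequence by metis
  \<comment> \<open>The cluster point \<open>l\<close> is itself an admissible reference point:
    \<open>f l\<close> is the limit of a subsequence of the decreasing values
    \<open>f (x k)\<close>.\<close>
  have "continuous_on UNIV f"
    using assms(1) unfolding continuously_differentiable_def
    by (simp add: continuous_at_imp_continuous_on differentiable_imp_continuous_within)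
  then have "(\<lambda>j. f (x (h j))) \<longlonglongrightarrow> f l"
    using lim by (auto intro: continuous_on_tendsto_compose simp: o_def)
  moreover have "f (x (h j)) \<le> f (x k)" if "j \<ge> k" for j k
    using decseqD[OF decf, of k "h j"] that seq_suble[OF h, of j] by simp
  ultimately have fl: "f l \<le> f (x k)" for k
    by (intro LIMSEQ_le_const2[of "\<lambda>j. f (x (h j))"]) auto
  \<comment> \<open>The matrix in \<open>D l (h j)\<close> varies with \<open>j\<close>; domination
    by a fixed multiple of the form of \<open>Q 0\<close> lets convergence of the points force this
    distance to 0.\<close>
  have Qbound: "v \<bullet> (Q k *v v) \<le> exp (suminf \<psi>) * (v \<bullet> (Q 0 *v v))" for v k
  proof -
    have "v \<bullet> (Q k *v v) \<le> (\<Prod>i<k. 1 + \<psi> i) * (v \<bullet> (Q 0 *v v))"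
    proof (induction k)
      case (Suc k)
      show ?case
        using order_trans[OF upper[of v k] mult_left_mono[OF Suc, of "1 + \<psi> k"]] assms(10)[of k]
        by (simp add: mult_ac)
    qed simp
    also have "\<dots> \<le> exp (suminf \<psi>) * (v \<bullet> (Q 0 *v v))"
      using prod_one_plus_bounded[OF assms(10,11)] nonneg by (intro mult_right_mono)
    finally show ?thesis .
  qed
  have "(\<lambda>j. exp (suminf \<psi>) * ((x (h j) - l) \<bullet> (Q 0 *v (x (h j) - l)))) \<longlonglongrightarrow>
    exp (suminf \<psi>) * ((l - l) \<bullet> (Q 0 *v (l - l)))"
    using lim unfolding o_def
    by (intro tendsto_intros bounded_linear.tendsto[OF matrix_vector_mul_bounded_linear])
  then have up0: "(\<lambda>j. exp (suminf \<psi>) * ((x (h j) - l) \<bullet> (Q 0 *v (x (h j) - l)))) \<longlonglongrightarrow> 0"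
    by simp
  have sub0: "(\<lambda>j. D l (h j)) \<longlonglongrightarrow> 0"
    by (rule tendsto_sandwich[OF _ _ tendsto_const up0]) (simp_all add: D_def nonneg Qbound)
  obtain d where d: "D l \<longlonglongrightarrow> d" using conv[OF fl] convergent_def by blast
  then have "d = 0"
    using LIMSEQ_subseq_LIMSEQ[OF d h] sub0 LIMSEQ_unique by (auto simp: o_def)
  \<comment> \<open>The lower bound \<open>a\<close> on all \<open>Q k\<close> converts the
    vanishing variable-metric distance into convergence in the Euclidean norm.\<close>
  have "norm (x k - l) \<le> sqrt (D l k / a)" for k
    using lower[of "x k - l" k] a by (intro real_le_rsqrt) (simp add: D_def field_simps)
  moreover have "(\<lambda>k. sqrt (D l k / a)) \<longlonglongrightarrow> sqrt (0 / a)"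
    using d \<open>d = 0\<close> a by (intro tendsto_intros) auto
  ultimately have "(\<lambda>k. x k - l) \<longlonglongrightarrow> 0"
    by (intro Lim_null_comparison[of "\<lambda>k. x k - l"]) auto
  then show ?thesis by (auto dest: LIM_zero_cancel)
qed

end
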